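(* Let $M$ and $N$ be matroids on disjoint finite sets $S$ and $T$, and let $A\subseteq S$, $B\subseteq T$. A subset $D$ of $S\cup T$ is a circuit of $(M,N;A,B)$ if and only if one of the following holds: (1) $D$ is a circuit of $M$; (2) $D$ is a circuit of $N$ and $D\subseteq T-B$; (3) $D=X\cup Y$ with $X\subseteq S$, $Y\subseteq T$, where (a) $X$ is independent in $M$ and no element of $X-A$ is a coloop of $M|(X\cup A)$, (b) $Y$ is a cyclic set of $N$ and $Y-B$ is independent in $N$, and (c) $|X|+|Y|-1=r_M(X\cup A)+r_N(Y)$.
   Context: A set in a matroid is cyclic if it is a (possibly empty) union of circuits. The principal sum $(M,N;A,B)$ is the matroid union $M^+(A,B)\vee N_0$, where: $N_0=N\oplus U_{0,S}$ ($N$ with the elements of $S$ added as loops); $M^+(A,B)$ is the matroid on $S\cup T$ obtained from $M$ by adding each element of $B$ freely (by successive principal extensions) to the flat $\mathrm{cl}_M(A)$ and each element of $T-B$ as a loop, equivalently the matroid with rank function $r(X\cup Y)=\min\{r_M(X\cup A),\,r_M(X)+|Y\cap B|\}$ for $X\subseteq S$, $Y\subseteq T$; and the matroid union $G\vee H$ of matroids on a common set has as independent sets the unions of an independent set of $G$ and an independent set of $H$. *)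

theory Defs
  imports Main
begin

section \<open>Matroids given by independent sets\<close>

record 'a set_system =
  ground :: "'a set"
  indeps :: "'a set set"

locale matroid =
  fixes M :: "'a set_system"
  assumes finite_ground: "finite (ground M)"
    and indeps_subset: "I \<in> indeps M \<Longrightarrow> I \<subseteq> ground M"
    and empty_indep: "{} \<in> indeps M"
    and subset_indep: "I \<in> indeps M \<Longrightarrow> J \<subseteq> I \<Longrightarrow> J \<in> indeps M"
    and augment: "I \<in> indeps M \<Longrightarrow> J \<in> indeps M \<Longrightarrow> card I < card J \<Longrightarrow>
      \<exists>x\<in>J - I. insert x I \<in> indeps M"

definition circuit :: "'a set_system \<Rightarrow> 'a set \<Rightarrow> bool" where
  "circuit M C \<longleftrightarrow> C \<subseteq> ground M \<and> C \<notin> indeps M \<and> (\<forall>C'. C' \<subset> C \<longrightarrow> C' \<in> indeps M)"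

definition cyclic :: "'a set_system \<Rightarrow> 'a set \<Rightarrow> bool" where
  "cyclic M Y \<longleftrightarrow> (\<exists>\<C>. (\<forall>C\<in>\<C>. circuit M C) \<and> Y = \<Union>\<C>)"

definition basis :: "'a set_system \<Rightarrow> 'a set \<Rightarrow> bool" where
  "basis M I \<longleftrightarrow> I \<in> indeps M \<and> (\<forall>J\<in>indeps M. I \<subseteq> J \<longrightarrow> J = I)"

definition coloop :: "'a set_system \<Rightarrow> 'a \<Rightarrow> bool" where
  "coloop M e \<longleftrightarrow> e \<in> ground M \<and> (\<forall>I. basis M I \<longrightarrow> e \<in> I)"

definition restriction :: "'a set_system \<Rightarrow> 'a set \<Rightarrow> 'a set_system" where
  "restriction M Z = \<lparr>ground = Z, indeps = {I \<in> indeps M. I \<subseteq> Z}\<rparr>"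

definition rank :: "'a set_system \<Rightarrow> 'a set \<Rightarrow> nat" where
  "rank M Z = Max (card ` {I \<in> indeps M. I \<subseteq> Z})"

definition closure :: "'a set_system \<Rightarrow> 'a set \<Rightarrow> 'a set" where
  "closure M Z = {e \<in> ground M. rank M (insert e Z) = rank M Z}"

definition uniform :: "nat \<Rightarrow> 'a set \<Rightarrow> 'a set_system" where
  "uniform k E = \<lparr>ground = E, indeps = {I. I \<subseteq> E \<and> card I \<le> k}\<rparr>"

text \<open>Only meant for matroids on disjoint ground sets.\<close>

definition direct_sum :: "'a set_system \<Rightarrow> 'a set_system \<Rightarrow> 'a set_system" where
  "direct_sum M N =
    \<lparr>ground = ground M \<union> ground N, indeps = {I \<union> J | I J. I \<in> indeps M \<and> J \<in> indeps N}\<rparr>"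

text \<open>Only meant for matroids on a common ground set.\<close>

definition matroid_union :: "'a set_system \<Rightarrow> 'a set_system \<Rightarrow> 'a set_system" where
  "matroid_union G H = \<lparr>ground = ground G, indeps = {I \<union> J | I J. I \<in> indeps G \<and> J \<in> indeps H}\<rparr>"

definition matroid_of_rank :: "'a set \<Rightarrow> ('a set \<Rightarrow> nat) \<Rightarrow> 'a set_system" where
  "matroid_of_rank E r = \<lparr>ground = E, indeps = {I. I \<subseteq> E \<and> r I = card I}\<rparr>"


section \<open>The principal sum\<close>

text \<open>
  The matroid \<open>M\<^sup>+(A,B)\<close> on \<open>ground M \<union> T\<close>, given by its rank function. The lemmas below confirm
  that it is a matroid with this rank function, and that it arises from \<open>M\<close> by successive
  principal extensions to the closure of \<open>A\<close> (for the elements of \<open>B\<close>) and by adding loops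
  (for the elements of \<open>T - B\<close>).
\<close>

definition principal_plus_rank ::
    "'a set_system \<Rightarrow> 'a set \<Rightarrow> 'a set \<Rightarrow> 'a set \<Rightarrow> 'a set \<Rightarrow> nat" where
  "principal_plus_rank M T A B Z =
    (let X = Z \<inter> ground M; Y = Z \<inter> T
     in min (rank M (X \<union> A)) (rank M X + card (Y \<inter> B)))"

definition principal_plus :: "'a set_system \<Rightarrow> 'a set \<Rightarrow> 'a set \<Rightarrow> 'a set \<Rightarrow> 'a set_system" where
  "principal_plus M T A B = matroid_of_rank (ground M \<union> T) (principal_plus_rank M T A B)"

definition principal_sum ::
    "'a set_system \<Rightarrow> 'a set_system \<Rightarrow> 'a set \<Rightarrow> 'a set \<Rightarrow> 'a set_system" where
  "principal_sum M N A B =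
    matroid_union (principal_plus M (ground N) A B) (direct_sum N (uniform 0 (ground M)))"

text \<open>
  Adding a new element \<open>e\<close> freely to the flat \<open>F\<close>: it raises the rank of exactly those sets whose
  closure does not contain \<open>F\<close>.
\<close>

definition principal_extension :: "'a set_system \<Rightarrow> 'a set \<Rightarrow> 'a \<Rightarrow> 'a set_system" where
  "principal_extension M F e = matroid_of_rank (insert e (ground M))
    (\<lambda>Z. if e \<notin> Z then rank M Z
         else if F \<subseteq> closure M (Z - {e}) then rank M (Z - {e})
         else rank M (Z - {e}) + 1)"


section \<open>Consistency of the definition of \<open>M\<^sup>+(A,B)\<close>\<close>

context matroid
begin

lemma finite_indep: "I \<in> indeps M \<Longrightarrow> finite I"
  by (rule finite_subset[OF indeps_subset finite_ground])

lemma finite_indeps_in: "finite {I \<in> indeps M. I \<subseteq> Z}"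
  by (rule finite_subset[of _ "Pow (ground M)"]) (use finite_ground indeps_subset in auto)

lemma card_le_rank: "I \<in> indeps M \<Longrightarrow> I \<subseteq> Z \<Longrightarrow> card I \<le> rank M Z"
  unfolding rank_def using finite_indeps_in by (intro Max_ge) auto

lemma rank_witness: obtains I where "I \<in> indeps M" "I \<subseteq> Z" "card I = rank M Z"
proof -
  have "rank M Z \<in> card ` {I \<in> indeps M. I \<subseteq> Z}"
    unfolding rank_def using finite_indeps_in empty_indep by (intro Max_in) auto
  then show thesis using that by auto
qed

lemma rank_mono:
  assumes "Z \<subseteq> Z'"
  shows "rank M Z \<le> rank M Z'"
proof -
  obtain I where I: "I \<in> indeps M" "I \<subseteq> Z" "card I = rank M Z" by (rule rank_witness)
  have "card I \<le> rank M Z'" by (rule card_le_rank[OF I(1)]) (use I assms in auto)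
  then show ?thesis using I by simp
qed

lemma rank_le_card:
  assumes "finite Z"
  shows "rank M Z \<le> card Z"
proof -
  obtain I where I: "I \<in> indeps M" "I \<subseteq> Z" "card I = rank M Z" by (rule rank_witness)
  have "card I \<le> card Z" by (rule card_mono[OF assms I(2)])
  then show ?thesis using I by simp
qed

lemma rank_eq_card_iff:
  assumes "Z \<subseteq> ground M"
  shows "rank M Z = card Z \<longleftrightarrow> Z \<in> indeps M"
proof
  have fin: "finite Z" by (rule finite_subset[OF assms finite_ground])
  obtain I where I: "I \<in> indeps M" "I \<subseteq> Z" "card I = rank M Z" by (rule rank_witness)
  assume "rank M Z = card Z"
  then have "I = Z" by (intro card_subset_eq[OF fin I(2)]) (use I in simp)
  then show "Z \<in> indeps M" using I by simp
next
  assume Z: "Z \<in> indeps M"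
  then show "rank M Z = card Z"
    using card_le_rank[OF Z order_refl] rank_le_card[OF finite_indep[OF Z]] by simp
qed

lemma extend_indep:
  assumes "I \<in> indeps M" "I \<subseteq> Z"
  obtains J where "J \<in> indeps M" "I \<subseteq> J" "J \<subseteq> Z" "card J = rank M Z"
proof -
  have "\<exists>J. J \<in> indeps M \<and> I \<subseteq> J \<and> J \<subseteq> Z \<and> card J = rank M Z"
    using assms
  proof (induction "rank M Z - card I" arbitrary: I)
    case 0
    then show ?case using card_le_rank[of I Z] by auto
  next
    case (Suc n)
    obtain K where K: "K \<in> indeps M" "K \<subseteq> Z" "card K = rank M Z" by (rule rank_witness)
    have "card I < card K" using K Suc.hyps(2) by simp
    then obtain x where x: "x \<in> K - I" "insert x I \<in> indeps M"
      using augment[OF Suc.prems(1) K(1)] by blast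
    have "n = rank M Z - card (insert x I)"
      using x Suc.hyps(2) finite_indep[OF Suc.prems(1)] by simp
    then show ?case using Suc.hyps(1)[of "insert x I"] x K Suc.prems by blast
  qed
  then show thesis using that by blast
qed

lemma rank_augment:
  assumes "I \<in> indeps M" "rank M I < rank M Z" "I \<subseteq> Z"
  shows "\<exists>x\<in>Z - I. insert x I \<in> indeps M"
proof -
  obtain K where "K \<in> indeps M" "K \<subseteq> Z" "card K = rank M Z" by (rule rank_witness)
  then show ?thesis
    using augment[OF assms(1), of K] assms rank_eq_card_iff[of I] indeps_subset by auto
qed

lemma rank_Un_basis:
  assumes "I \<in> indeps M" "I \<subseteq> X" "card I = rank M X"
  shows "rank M (I \<union> A) = rank M (X \<union> A)"
proof (rule antisym)
  show "rank M (I \<union> A) \<le> rank M (X \<union> A)" using assms by (intro rank_mono) auto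
  obtain J where J: "J \<in> indeps M" "I \<subseteq> J" "J \<subseteq> X \<union> A" "card J = rank M (X \<union> A)"
    using extend_indep[of I "X \<union> A"] assms by blast
  have "J \<inter> X = I"
  proof (rule sym, rule card_seteq)
    show "finite (J \<inter> X)" using finite_indep[OF J(1)] by simp
    show "I \<subseteq> J \<inter> X" using J assms by blast
    show "card (J \<inter> X) \<le> card I"
      using card_le_rank[of "J \<inter> X" X] subset_indep[OF J(1), of "J \<inter> X"] assms by auto
  qed
  then have "J \<subseteq> I \<union> A" using J by blast
  then show "rank M (X \<union> A) \<le> rank M (I \<union> A)" using card_le_rank[OF J(1), of "I \<union> A"] J(4) by simp
qed

lemma rank_Un_closed:
  assumes "\<And>a. a \<in> A \<Longrightarrow> rank M (insert a X) = rank M X"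
  shows "rank M (X \<union> A) = rank M X"
proof (rule ccontr)
  assume "rank M (X \<union> A) \<noteq> rank M X"
  then have lt: "rank M X < rank M (X \<union> A)" using rank_mono[of X "X \<union> A"] by auto
  obtain I where I: "I \<in> indeps M" "I \<subseteq> X" "card I = rank M X" by (rule rank_witness)
  have "rank M I < rank M (X \<union> A)"
    using lt I rank_eq_card_iff[of I] indeps_subset by auto
  then obtain x where x: "x \<in> X \<union> A - I" "insert x I \<in> indeps M"
    using rank_augment[of I "X \<union> A"] I by auto
  have "card (insert x I) = Suc (rank M X)" using x I finite_indep by auto
  moreover have "card (insert x I) \<le> rank M (insert x X)" 
    by (rule card_le_rank[OF x(2)]) (use I in auto)
  moreover have "rank M (insert x X) = rank M X"
    using x assms by (cases "x \<in> X") (auto simp: insert_absorb)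
  ultimately show False by simp
qed

lemma rank_insert_le: "rank M (insert x X) \<le> Suc (rank M X)"
proof -
  obtain I where I: "I \<in> indeps M" "I \<subseteq> insert x X" "card I = rank M (insert x X)"
    by (rule rank_witness)
  have "card (I - {x}) \<le> rank M X"
    by (rule card_le_rank[OF subset_indep[OF I(1)]]) (use I in auto)
  then show ?thesis using I finite_indep[OF I(1)] by (cases "x \<in> I") auto
qed

lemma rank_insert_closure: "f \<in> closure M A \<Longrightarrow> rank M (insert f (X \<union> A)) = rank M (X \<union> A)"
proof -
  assume f: "f \<in> closure M A"
  obtain I where I: "I \<in> indeps M" "I \<subseteq> A" "card I = rank M A" by (rule rank_witness)
  have "rank M (I \<union> (X \<union> {f})) = rank M (insert f A \<union> (X \<union> {f}))"
    by (rule rank_Un_basis) (use I f in \<open>auto simp: closure_def\<close>)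
  moreover have "rank M (I \<union> X) = rank M (insert f A \<union> X)"
    by (rule rank_Un_basis) (use I f in \<open>auto simp: closure_def\<close>)
  moreover have "rank M (I \<union> X) = rank M (A \<union> X)"
    by (rule rank_Un_basis) (use I in auto)
  ultimately show ?thesis by (simp add: Un_commute)
qed

end

lemma (in matroid) principal_plus_indep_iff:
  assumes "finite T" "ground M \<inter> T = {}" "B \<subseteq> T" "X \<subseteq> ground M" "Y \<subseteq> T"
  shows "X \<union> Y \<in> indeps (principal_plus M T A B) \<longleftrightarrow>
    X \<in> indeps M \<and> Y \<subseteq> B \<and> card X + card Y \<le> rank M (X \<union> A)"
proof -
  have XY: "(X \<union> Y) \<inter> ground M = X" "(X \<union> Y) \<inter> T = Y" using assms by auto
  have fin: "finite X" "finite Y"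
    by (rule finite_subset[OF assms(4) finite_ground], rule finite_subset[OF assms(5,1)])
  have c: "card (X \<union> Y) = card X + card Y"
    by (rule card_Un_disjoint) (use fin assms in auto)
  have 1: "rank M X \<le> card X" using rank_le_card fin by blast
  have 2: "card (Y \<inter> B) \<le> card Y" using fin by (simp add: card_mono)
  have 3: "card (Y \<inter> B) = card Y \<longleftrightarrow> Y \<subseteq> B" using fin
    by (metis Int_absorb2 Int_iff Int_lower1 card_subset_eq subsetI)
  have "X \<union> Y \<in> indeps (principal_plus M T A B) \<longleftrightarrow>
    min (rank M (X \<union> A)) (rank M X + card (Y \<inter> B)) = card X + card Y"
    unfolding principal_plus_def matroid_of_rank_def principal_plus_rank_def Let_def
    using XY c assms by auto
  also have "\<dots> \<longleftrightarrow> rank M X = card X \<and> card (Y \<inter> B) = card Y \<and>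
      card X + card Y \<le> rank M (X \<union> A)"
    using 1 2 by (auto simp: min_def)
  finally show ?thesis using 3 rank_eq_card_iff[OF assms(4)] by simp
qed

lemma ground_principal_plus [simp]: "ground (principal_plus M T A B) = ground M \<union> T"
  by (simp add: principal_plus_def matroid_of_rank_def)

lemma (in matroid) matroid_principal_plus:
  assumes T: "finite T" "ground M \<inter> T = {}" "B \<subseteq> T"
  shows "matroid (principal_plus M T A B)"
proof -
  let ?P = "principal_plus M T A B"
  note iff = principal_plus_indep_iff[OF T, of _ _ A]
  have split: "\<exists>X Y. I = X \<union> Y \<and> X \<subseteq> ground M \<and> Y \<subseteq> T" if "I \<subseteq> ground M \<union> T" for I
    using that by (intro exI[of _ "I \<inter> ground M"] exI[of _ "I \<inter> T"]) auto
  have sub: "I \<subseteq> ground M \<union> T" if "I \<in> indeps ?P" for I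
    using that by (simp add: principal_plus_def matroid_of_rank_def)
  have cardU: "card (X \<union> Y) = card X + card Y" if "X \<subseteq> ground M" "Y \<subseteq> T" for X Y
    by (rule card_Un_disjoint) (use that T in \<open>auto intro: finite_subset[OF _ finite_ground] finite_subset[OF _ T(1)]\<close>)
  show ?thesis
  proof
    show "finite (ground ?P)" using finite_ground T by simp
  next
    fix I assume "I \<in> indeps ?P" then show "I \<subseteq> ground ?P" using sub by simp
  next
    show "{} \<in> indeps ?P" using iff[of "{}" "{}"] empty_indep by simp
  next
    fix I J assume I: "I \<in> indeps ?P" and J: "J \<subseteq> I"
    obtain X Y where XY: "I = X \<union> Y" "X \<subseteq> ground M" "Y \<subseteq> T" using split[OF sub[OF I]] by (elim exE conjE)
    have X: "X \<in> indeps M" "Y \<subseteq> B" "card X + card Y \<le> rank M (X \<union> A)"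
      using I iff[of X Y] XY by auto
    define X' Y' where "X' = J \<inter> X" and "Y' = J \<inter> Y"
    have J': "J = X' \<union> Y'" "X' \<subseteq> X" "Y' \<subseteq> Y" using J XY X'_def Y'_def by auto
    have X': "X' \<in> indeps M" using X J' subset_indep by blast
    have fX: "finite X" "finite Y" using X XY by (auto intro: finite_indep finite_subset[OF _ T(1)])
    have "rank M (X \<union> A) \<le> rank M (X' \<union> A) + card (X - X')"
    proof -
      obtain K where K: "K \<in> indeps M" "K \<subseteq> X \<union> A" "card K = rank M (X \<union> A)"
        by (rule rank_witness)
      have "card (K - (X - X')) \<le> rank M (X' \<union> A)"
        by (rule card_le_rank[OF subset_indep[OF K(1)]]) (use K in auto)
      moreover have "card K - card (X - X') \<le> card (K - (X - X'))"
        by (rule diff_card_le_card_Diff) (use fX in auto)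
      ultimately show ?thesis using K by linarith
    qed
    moreover have "card (X - X') = card X - card X'" "card X' \<le> card X" "card Y' \<le> card Y"
      using J' fX by (auto simp: card_Diff_subset finite_subset card_mono)
    ultimately have "card X' + card Y' \<le> rank M (X' \<union> A)" using X by linarith
    then show "J \<in> indeps ?P" using iff[of X' Y'] J' X X' XY by auto
  next
    fix I J assume I: "I \<in> indeps ?P" and J: "J \<in> indeps ?P" and lt: "card I < card J"
    obtain X Y where XY: "I = X \<union> Y" "X \<subseteq> ground M" "Y \<subseteq> T" using split[OF sub[OF I]] by (elim exE conjE)
    obtain X' Y' where XY': "J = X' \<union> Y'" "X' \<subseteq> ground M" "Y' \<subseteq> T" using split[OF sub[OF J]] by (elim exE conjE)
    have X: "X \<in> indeps M" "Y \<subseteq> B" "card X + card Y \<le> rank M (X \<union> A)"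
      using I iff[of X Y] XY by auto
    have X': "X' \<in> indeps M" "Y' \<subseteq> B" "card X' + card Y' \<le> rank M (X' \<union> A)"
      using J iff[of X' Y'] XY' by auto
    have lt': "card X + card Y < card X' + card Y'" using lt cardU XY XY' by simp
    have fX: "finite X" "finite Y" "finite X'" "finite Y'"
      using X X' XY XY' by (auto intro: finite_indep finite_subset[OF _ T(1)])
    have addx: "\<exists>x\<in>J - I. insert x I \<in> indeps ?P"
      if x: "x \<in> X' - X" "insert x X \<in> indeps M"
        "card X + card Y + 1 \<le> rank M (insert x X \<union> A)" for x
    proof
      show "insert x I \<in> indeps ?P"
        using iff[of "insert x X" Y] x X XY XY' fX by auto
      show "x \<in> J - I" using x XY XY' T by auto
    qed
    show "\<exists>x\<in>J - I. insert x I \<in> indeps ?P"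
    proof (cases "card X + card Y < rank M (X \<union> A)")
      case True
      show ?thesis
      proof (cases "card X < card X'")
        case t: True
        obtain x where x: "x \<in> X' - X" "insert x X \<in> indeps M" using augment[OF X(1) X'(1) t] by blast
        have "rank M (X \<union> A) \<le> rank M (insert x X \<union> A)" by (rule rank_mono) auto
        then show ?thesis using addx[OF x] True by simp
      next
        case False
        then have "card Y < card Y'" using lt' by simp
        then have "\<not> Y' \<subseteq> Y" using card_mono[OF fX(2), of Y'] by auto
        then obtain y where y: "y \<in> Y'" "y \<notin> Y" by blast
        have "y \<in> T" "y \<in> B" using y XY' X' by auto
        then have "insert y I \<in> indeps ?P"
          using iff[of X "insert y Y"] y X X' XY XY' fX True by auto
        moreover have "y \<in> J - I" using y XY XY' T by auto
        ultimately show ?thesis by blast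
      qed
    next
      case False
      then have eq: "card X + card Y = rank M (X \<union> A)" using X by simp
      have "rank M (X \<union> A) < rank M (X \<union> A \<union> X')"
      proof -
        have "rank M (X' \<union> A) \<le> rank M (X \<union> A \<union> X')" by (rule rank_mono) auto
        then show ?thesis using eq lt' X'(3) by linarith
      qed
      then obtain x where x: "x \<in> X'" "rank M (insert x (X \<union> A)) \<noteq> rank M (X \<union> A)"
        using rank_Un_closed[of X' "X \<union> A"] by fastforce
      then have gt: "rank M (X \<union> A) < rank M (insert x (X \<union> A))"
        using rank_mono[OF subset_insertI, of "X \<union> A" x] by linarith
      have xX: "x \<notin> X" using x by (auto simp: insert_absorb)
      have "insert x X \<in> indeps M"
      proof (rule ccontr)
        assume n: "insert x X \<notin> indeps M"
        have "rank M (insert x X) \<noteq> card (insert x X)"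
          using n rank_eq_card_iff[of "insert x X"] XY XY' x by auto
        moreover have "rank M (insert x X) \<le> card (insert x X)" using rank_le_card fX by auto
        moreover have "rank M X = card X" using rank_eq_card_iff XY X by auto
        ultimately have "rank M (insert x X) = card X"
          using rank_mono[OF subset_insertI, of X x] xX fX by simp
        then have "rank M (X \<union> A) = rank M (insert x X \<union> A)"
          by (intro rank_Un_basis) (use X in auto)
        then show False using gt by simp
      qed
      then show ?thesis using addx[of x] x xX gt eq by simp
    qed
  qed
qed

lemma (in matroid) rank_principal_plus:
  assumes T: "finite T" "ground M \<inter> T = {}" "B \<subseteq> T" and XY: "X \<subseteq> ground M" "Y \<subseteq> T"
  shows "rank (principal_plus M T A B) (X \<union> Y) =
    min (rank M (X \<union> A)) (rank M X + card (Y \<inter> B))"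
proof -
  let ?P = "principal_plus M T A B"
  interpret P: matroid ?P by (rule matroid_principal_plus[OF T])
  note iff = principal_plus_indep_iff[OF T, of _ _ A]
  have cardU: "card (X \<union> Y) = card X + card Y" if "X \<subseteq> ground M" "Y \<subseteq> T" for X Y
    by (rule card_Un_disjoint) (use that T in \<open>auto intro: finite_subset[OF _ finite_ground] finite_subset[OF _ T(1)]\<close>)
  show ?thesis
  proof (rule antisym)
    obtain I where I: "I \<in> indeps ?P" "I \<subseteq> X \<union> Y" "card I = rank ?P (X \<union> Y)"
      by (rule P.rank_witness)
    define X' Y' where "X' = I \<inter> X" and "Y' = I \<inter> Y"
    have I': "I = X' \<union> Y'" "X' \<subseteq> X" "Y' \<subseteq> Y" using I X'_def Y'_def by auto
    then have J: "X' \<in> indeps M" "Y' \<subseteq> B" "card X' + card Y' \<le> rank M (X' \<union> A)"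
      using I iff[of X' Y'] XY by auto
    have "rank M (X' \<union> A) \<le> rank M (X \<union> A)" using I' by (intro rank_mono) auto
    moreover have "card X' \<le> rank M X" using card_le_rank J I' by blast
    moreover have "card Y' \<le> card (Y \<inter> B)"
      by (rule card_mono) (use XY I' J in \<open>auto intro: finite_subset[OF _ T(1)]\<close>)
    moreover have "card I = card X' + card Y'" using I' cardU[of X' Y'] XY by auto
    ultimately show "rank ?P (X \<union> Y) \<le> min (rank M (X \<union> A)) (rank M X + card (Y \<inter> B))"
      using I J by linarith
  next
    obtain X' where X': "X' \<in> indeps M" "X' \<subseteq> X" "card X' = rank M X" by (rule rank_witness)
    have r: "rank M (X' \<union> A) = rank M (X \<union> A)" by (rule rank_Un_basis[OF X'])
    have le: "rank M X \<le> rank M (X \<union> A)" by (rule rank_mono) auto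
    obtain Y' where Y': "Y' \<subseteq> Y \<inter> B" "card Y' = min (card (Y \<inter> B)) (rank M (X \<union> A) - rank M X)"
      by (meson min.cobounded1 obtain_subset_with_card_n)
    have "X' \<union> Y' \<in> indeps ?P" using iff[of X' Y'] X' Y' XY r le by auto
    then have "card (X' \<union> Y') \<le> rank ?P (X \<union> Y)"
      by (rule P.card_le_rank) (use X' Y' in auto)
    moreover have "card (X' \<union> Y') = card X' + card Y'" using cardU[of X' Y'] X' Y' XY by auto
    ultimately show "min (rank M (X \<union> A)) (rank M X + card (Y \<inter> B)) \<le> rank ?P (X \<union> Y)"
      using X' Y' le by linarith
  qed
qed

lemma (in matroid) principal_plus_empty: "principal_plus M {} A {} = M"
proof -
  have "I \<in> indeps (principal_plus M {} A {}) \<longleftrightarrow> I \<in> indeps M" for I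
  proof (cases "I \<subseteq> ground M")
    case True
    have "card I \<le> rank M (I \<union> A)" if "I \<in> indeps M" using that card_le_rank by auto
    then show ?thesis using principal_plus_indep_iff[of "{}" "{}" I "{}" A] True by auto
  next
    case False
    then show ?thesis using indeps_subset
      by (auto simp: principal_plus_def matroid_of_rank_def)
  qed
  then show ?thesis by (intro set_system.equality) auto
qed

lemma (in matroid) principal_plus_loop:
  assumes T: "finite T" "ground M \<inter> T = {}" "B \<subseteq> T" and t: "t \<notin> ground M \<union> T"
  shows "principal_plus M (insert t T) A B = direct_sum (principal_plus M T A B) (uniform 0 {t})"
proof -
  have T': "finite (insert t T)" "ground M \<inter> insert t T = {}" "B \<subseteq> insert t T" using assms by auto
  have sub: "I \<subseteq> ground M \<union> T" if "I \<in> indeps (principal_plus M T A B)" for I T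
    using that by (simp add: principal_plus_def matroid_of_rank_def)
  have "I \<in> indeps (principal_plus M (insert t T) A B) \<longleftrightarrow> I \<in> indeps (principal_plus M T A B)" for I
  proof (cases "I \<subseteq> ground M \<union> insert t T")
    case True
    define X Y where "X = I \<inter> ground M" and "Y = I \<inter> insert t T"
    have XY: "X \<subseteq> ground M" "Y \<subseteq> insert t T" "I = X \<union> Y" using True X_def Y_def by auto
    note iff = principal_plus_indep_iff[OF T' XY(1,2), of A]
    show ?thesis
    proof (cases "t \<in> Y")
      case t': True
      then have "\<not> Y \<subseteq> B" using T t by blast
      then have "I \<notin> indeps (principal_plus M (insert t T) A B)" using iff XY(3) by blast
      moreover have "I \<notin> indeps (principal_plus M T A B)" using sub[of I T] t' t XY(3) by blast
      ultimately show ?thesis by blast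
    next
      case False
      then have "Y \<subseteq> T" using XY(2) by blast
      then show ?thesis
        using principal_plus_indep_iff[OF T XY(1), of Y A] iff XY(3) by blast
    qed
  next
    case False
    have "I \<notin> indeps (principal_plus M (insert t T) A B)" using sub[of I "insert t T"] False by blast
    moreover have "I \<notin> indeps (principal_plus M T A B)" using sub[of I T] False by blast
    ultimately show ?thesis by blast
  qed
  moreover have "indeps (uniform 0 {t}) = {{}}"
    by (auto simp: uniform_def subset_singleton_iff)
  then have "indeps (direct_sum (principal_plus M T A B) (uniform 0 {t})) =
      indeps (principal_plus M T A B)"
    by (simp add: direct_sum_def)
  ultimately have "indeps (principal_plus M (insert t T) A B) =
      indeps (direct_sum (principal_plus M T A B) (uniform 0 {t}))"
    by blast
  then show ?thesis
    by (intro set_system.equality) (auto simp: direct_sum_def uniform_def)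
qed

lemma (in matroid) principal_plus_insert:
  assumes T: "finite T" "ground M \<inter> T = {}" "B \<subseteq> T" and b: "b \<notin> ground M \<union> T"
    and A: "A \<subseteq> ground M"
  shows "principal_plus M (insert b T) A (insert b B) =
    principal_extension (principal_plus M T A B) (closure M A) b"
proof -
  let ?P = "principal_plus M T A B"
  interpret P: matroid ?P by (rule matroid_principal_plus[OF T])
  note rk = rank_principal_plus[OF T, of _ _ A]
  have "principal_plus_rank M (insert b T) A (insert b B) Z =
    (if b \<notin> Z then rank ?P Z
     else if closure M A \<subseteq> closure ?P (Z - {b}) then rank ?P (Z - {b})
     else rank ?P (Z - {b}) + 1)" if Z: "Z \<subseteq> insert b (ground M \<union> T)" for Z
  proof -
    define X Y where "X = Z \<inter> ground M" and "Y = Z \<inter> T"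
    have XY: "X \<subseteq> ground M" "Y \<subseteq> T" "Z - {b} = X \<union> Y" using Z b X_def Y_def by auto
    have fY: "finite Y" using XY T(1) by (auto intro: finite_subset)
    show ?thesis
    proof (cases "b \<in> Z")
      case False
      then have "Z = X \<union> Y" "Z \<inter> insert b T \<inter> insert b B = Y \<inter> B"
        using XY b T Y_def by auto
      then show ?thesis using rk[OF XY(1,2)] False X_def
        unfolding principal_plus_rank_def Let_def by simp
    next
      case True
      have "Z \<inter> insert b T \<inter> insert b B = insert b (Y \<inter> B)" "b \<notin> Y"
        using True b T Y_def by auto
      then have l: "principal_plus_rank M (insert b T) A (insert b B) Z =
        min (rank M (X \<union> A)) (rank M X + card (Y \<inter> B) + 1)"
        using fY X_def unfolding principal_plus_rank_def Let_def by simp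
      have cl: "closure M A \<subseteq> closure ?P (X \<union> Y) \<longleftrightarrow> rank M (X \<union> A) \<le> rank M X + card (Y \<inter> B)"
      proof
        assume le: "rank M (X \<union> A) \<le> rank M X + card (Y \<inter> B)"
        show "closure M A \<subseteq> closure ?P (X \<union> Y)"
        proof
          fix f assume f: "f \<in> closure M A"
          then have fg: "f \<in> ground M" by (simp add: closure_def)
          have "rank ?P (insert f (X \<union> Y)) = 
             min (rank M (insert f X \<union> A)) (rank M (insert f X) + card (Y \<inter> B))"
            using rk[of "insert f X" Y] XY fg by simp
          moreover have "rank M (insert f X \<union> A) = rank M (X \<union> A)"
            using rank_insert_closure[OF f] by simp
          moreover have "rank M X \<le> rank M (insert f X)" by (rule rank_mono) auto
          ultimately have "rank ?P (insert f (X \<union> Y)) = rank ?P (X \<union> Y)"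
            using le rk[OF XY(1,2)] by simp
          then show "f \<in> closure ?P (X \<union> Y)" using fg by (simp add: closure_def)
        qed
      next
        assume sub: "closure M A \<subseteq> closure ?P (X \<union> Y)"
        show "rank M (X \<union> A) \<le> rank M X + card (Y \<inter> B)"
        proof (rule ccontr)
          assume n: "\<not> ?thesis"
          then obtain a where a: "a \<in> A" "rank M (insert a X) \<noteq> rank M X"
            using rank_Un_closed[of A X] by fastforce
          have "a \<in> closure M A" using a A by (auto simp: closure_def insert_absorb)
          then have "rank ?P (insert a (X \<union> Y)) = rank ?P (X \<union> Y)"
            using sub by (auto simp: closure_def)
          moreover have "rank ?P (insert a (X \<union> Y)) =
             min (rank M (insert a X \<union> A)) (rank M (insert a X) + card (Y \<inter> B))"
            using rk[of "insert a X" Y] XY a A by auto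
          moreover have "insert a X \<union> A = X \<union> A" using a by auto
          moreover have "rank M X < rank M (insert a X)"
            using a(2) rank_mono[OF subset_insertI, of X a] by linarith
          ultimately show False using n rk[OF XY(1,2)] by (auto simp: min_def split: if_splits)
        qed
      qed
      show ?thesis using l cl rk[OF XY(1,2)] XY(3) True by (auto simp: min_def)
    qed
  qed
  then have "{I. I \<subseteq> insert b (ground M \<union> T) \<and>
        principal_plus_rank M (insert b T) A (insert b B) I = card I} =
      {I. I \<subseteq> insert b (ground M \<union> T) \<and>
        (if b \<notin> I then rank ?P I
         else if closure M A \<subseteq> closure ?P (I - {b}) then rank ?P (I - {b})
         else rank ?P (I - {b}) + 1) = card I}"
    by (intro Collect_cong conj_cong refl) simp
  then show ?thesis
    by (simp only: principal_plus_def[of M "insert b T"] principal_extension_def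
        matroid_of_rank_def ground_principal_plus Un_insert_right)
qed

end

theory Submission
  imports Defs
begin

text \<open>
  Taking the \<open>N\<close>-part of \<open>Y\<close> to be a basis of \<open>Y\<close> containing \<open>Y - B\<close>, a set \<open>X \<union> Y\<close> is independent in
  the principal sum iff \<open>X\<close> is independent in \<open>M\<close>, \<open>Y - B\<close> is independent in \<open>N\<close>, and
  \<open>|X| + |Y| \<le> r\<^sub>M(X \<union> A) + r\<^sub>N(Y)\<close>. A circuit is a minimal set violating one of these
  conditions. For the first two it is a circuit of \<open>M\<close>, or of \<open>N\<close> inside \<open>T - B\<close>. When only the
  inequality is violated, minimality means that it fails by one and that neither rank on
  the right drops when an element of \<open>X \<union> Y\<close> is deleted, i.e. no element of \<open>X - A\<close> is a coloop of
  \<open>M|(X \<union> A)\<close> and \<open>Y\<close> is cyclic.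
\<close>

section \<open>Coloops and cyclic sets in terms of rank\<close>

context matroid
begin

text \<open>The bridge between rank conditions and bases: the set on the right is a basis of
  \<open>Z\<close> that avoids \<open>x\<close>. One inequality suffices, since the other is
  monotonicity of rank.\<close>

lemma rank_le_rank_iff_subset_avoiding:
  "rank M Z \<le> rank M (Z - {x}) \<longleftrightarrow> (\<exists>I\<in>indeps M. I \<subseteq> Z - {x} \<and> card I = rank M Z)"
  by (metis Diff_subset antisym card_le_rank rank_mono rank_witness)

lemma basis_restriction_iff:
  "basis (restriction M Z) I \<longleftrightarrow> I \<in> indeps M \<and> I \<subseteq> Z \<and> card I = rank M Z"
proof
  assume b: "basis (restriction M Z) I"
  then have I: "I \<in> indeps M" "I \<subseteq> Z" by (auto simp: basis_def restriction_def)
  obtain J where "J \<in> indeps M" "I \<subseteq> J" "J \<subseteq> Z" "card J = rank M Z"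
    by (rule extend_indep[OF I])
  moreover from this have "J = I" using b by (auto simp: basis_def restriction_def)
  ultimately show "I \<in> indeps M \<and> I \<subseteq> Z \<and> card I = rank M Z" by simp
next
  assume I: "I \<in> indeps M \<and> I \<subseteq> Z \<and> card I = rank M Z"
  have "J = I" if "J \<in> indeps M" "J \<subseteq> Z" "I \<subseteq> J" for J
    using card_seteq[OF finite_indep[OF that(1)] that(3)] card_le_rank[OF that(1,2)] I by simp
  then show "basis (restriction M Z) I" using I by (auto simp: basis_def restriction_def)
qed

lemma coloop_restriction_iff:
  "coloop (restriction M Z) x \<longleftrightarrow> x \<in> Z \<and> rank M (Z - {x}) < rank M Z"
  unfolding coloop_def basis_restriction_iff not_le[symmetric] rank_le_rank_iff_subset_avoiding
  by (auto simp: restriction_def subset_Diff_insert)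

lemma dependent_contains_circuit:
  assumes "Z \<subseteq> ground M" "Z \<notin> indeps M"
  obtains C where "circuit M C" "C \<subseteq> Z"
proof -
  have "finite Z" by (rule finite_subset[OF assms(1) finite_ground])
  then have "finite {C. C \<subseteq> Z \<and> C \<notin> indeps M}" by simp
  then obtain C where "C \<subseteq> Z \<and> C \<notin> indeps M"
    and "\<forall>C'. C' \<subseteq> Z \<and> C' \<notin> indeps M \<longrightarrow> C' \<subseteq> C \<longrightarrow> C = C'"
    using finite_has_minimal[of "{C. C \<subseteq> Z \<and> C \<notin> indeps M}"] assms(2) by auto
  then have "circuit M C \<and> C \<subseteq> Z" using assms(1) unfolding circuit_def by blast
  then show thesis using that by blast
qed

text \<open>For a circuit \<open>C\<close> through \<open>y\<close> inside \<open>Y\<close>, a basis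
  of \<open>Y\<close> grown from \<open>C - {y}\<close> must miss \<open>y\<close>, or it would
  contain \<open>C\<close>. Conversely, adding \<open>y\<close> to a basis of \<open>Y\<close> that
  avoids it creates a circuit, which has to pass through \<open>y\<close>.\<close>

lemma cyclic_iff_rank_delete:
  "cyclic M Y \<longleftrightarrow> Y \<subseteq> ground M \<and> (\<forall>y\<in>Y. rank M Y \<le> rank M (Y - {y}))"
proof (intro iffI conjI ballI)
  assume "cyclic M Y"
  then obtain F where F: "\<forall>C\<in>F. circuit M C" "Y = \<Union>F" by (auto simp: cyclic_def)
  then show "Y \<subseteq> ground M" by (auto simp: circuit_def)
  fix y assume "y \<in> Y"
  then obtain C where C: "circuit M C" "C \<subseteq> Y" "y \<in> C" using F by auto
  then have "C - {y} \<in> indeps M" "C - {y} \<subseteq> Y" by (auto simp: circuit_def)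
  then obtain J where J: "J \<in> indeps M" "C - {y} \<subseteq> J" "J \<subseteq> Y" "card J = rank M Y"
    by (rule extend_indep)
  have "y \<notin> J"
  proof
    assume "y \<in> J"
    then have "C \<subseteq> J" using J(2) by blast
    then show False using C(1) subset_indep[OF J(1)] by (auto simp: circuit_def)
  qed
  then show "rank M Y \<le> rank M (Y - {y})"
    using J unfolding rank_le_rank_iff_subset_avoiding by blast
next
  assume Y: "Y \<subseteq> ground M \<and> (\<forall>y\<in>Y. rank M Y \<le> rank M (Y - {y}))"
  have "\<exists>C. circuit M C \<and> C \<subseteq> Y \<and> y \<in> C" if y: "y \<in> Y" for y
  proof -
    obtain I where I: "I \<in> indeps M" "I \<subseteq> Y - {y}" "card I = rank M Y"
      using Y y unfolding rank_le_rank_iff_subset_avoiding by blast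
    have sub: "insert y I \<subseteq> Y" using y I by blast
    have "card (insert y I) = Suc (rank M Y)"
      using I finite_indep[OF I(1)] by (simp add: subset_Diff_insert)
    then have "insert y I \<notin> indeps M" using card_le_rank[of "insert y I" Y] sub by auto
    moreover have "insert y I \<subseteq> ground M" using sub Y by blast
    ultimately obtain C where C: "circuit M C" "C \<subseteq> insert y I"
      using dependent_contains_circuit by blast
    have "\<not> C \<subseteq> I" using C(1) subset_indep[OF I(1)] by (auto simp: circuit_def)
    then show ?thesis using C sub by blast
  qed
  then have "Y = \<Union>{C. circuit M C \<and> C \<subseteq> Y}" by blast
  then show "cyclic M Y"
    unfolding cyclic_def by (intro exI[of _ "{C. circuit M C \<and> C \<subseteq> Y}"]) simp
qed

end

section \<open>Independent sets of the principal sum\<close>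

lemma ground_principal_sum [simp]: "ground (principal_sum M N A B) = ground M \<union> ground N"
  by (simp add: principal_sum_def matroid_union_def)

lemma indeps_principal_sum:
  assumes "finite (ground M)"
  shows "indeps (principal_sum M N A B) =
    {I \<union> J | I J. I \<in> indeps (principal_plus M (ground N) A B) \<and> J \<in> indeps N}"
proof -
  \<comment> \<open>Infinite sets have \<open>card\<close> 0, so finiteness is what leaves only the
    empty set independent here.\<close>
  have "indeps (uniform 0 (ground M)) = {{}}"
    using assms by (auto simp: uniform_def dest: finite_subset)
  then have "indeps (direct_sum N (uniform 0 (ground M))) = indeps N"
    by (simp add: direct_sum_def)
  then show ?thesis by (simp add: principal_sum_def matroid_union_def)
qed

lemma principal_sum_indep_iff:
  assumes "matroid M" "matroid N" "ground M \<inter> ground N = {}" "B \<subseteq> ground N"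
    and X: "X \<subseteq> ground M" and Y: "Y \<subseteq> ground N"
  shows "X \<union> Y \<in> indeps (principal_sum M N A B) \<longleftrightarrow>
    X \<in> indeps M \<and> Y - B \<in> indeps N \<and> card X + card Y \<le> rank M (X \<union> A) + rank N Y"
proof -
  interpret M: matroid M by fact
  interpret N: matroid N by fact
  note plus_iff = M.principal_plus_indep_iff[OF N.finite_ground assms(3,4), of _ _ A]
  have finY: "finite Y" by (rule finite_subset[OF Y N.finite_ground])
  show ?thesis
  proof
    assume "X \<union> Y \<in> indeps (principal_sum M N A B)"
    then obtain I J where IJ: "X \<union> Y = I \<union> J" "I \<in> indeps (principal_plus M (ground N) A B)"
        "J \<in> indeps N"
      using indeps_principal_sum[OF M.finite_ground] by auto
    have J: "J \<subseteq> Y" using IJ(1) N.indeps_subset[OF IJ(3)] X assms(3) by blast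
    have "I = X \<union> (I \<inter> Y)" using IJ(1) J Y X assms(3) by blast
    then have ind: "X \<in> indeps M" "I \<inter> Y \<subseteq> B" "card X + card (I \<inter> Y) \<le> rank M (X \<union> A)"
      using plus_iff[of X "I \<inter> Y"] IJ(2) X Y by auto
    have YIJ: "Y = (I \<inter> Y) \<union> J" using IJ(1) J by blast
    \<comment> \<open>Elements of \<open>Y - B\<close> are loops of the
      \<open>principal_plus\<close> part, so \<open>J\<close> has to supply them all.\<close>
    then have "Y - B \<subseteq> J" using ind(2) by blast
    moreover have "card Y \<le> card (I \<inter> Y) + card J" by (metis YIJ card_Un_le)
    moreover have "card J \<le> rank N Y" by (rule N.card_le_rank[OF IJ(3) J])
    ultimately show "X \<in> indeps M \<and> Y - B \<in> indeps N \<and>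
        card X + card Y \<le> rank M (X \<union> A) + rank N Y"
      using ind N.subset_indep[OF IJ(3)] by auto
  next
    assume r: "X \<in> indeps M \<and> Y - B \<in> indeps N \<and>
        card X + card Y \<le> rank M (X \<union> A) + rank N Y"
    \<comment> \<open>A \<open>J\<close> of full rank leaves as few elements as possible to the
      \<open>principal_plus\<close> part, and containing \<open>Y - B\<close> keeps that remainder
      \<open>Y - J\<close> inside \<open>B\<close>.\<close>
    then obtain J where J: "J \<in> indeps N" "Y - B \<subseteq> J" "J \<subseteq> Y" "card J = rank N Y"
      using N.extend_indep[of "Y - B" Y] by blast
    have "card (Y - J) + card J = card Y"
      using card_Diff_subset[OF finite_subset[OF J(3) finY] J(3)] card_mono[OF finY J(3)] by simp
    then have "X \<union> (Y - J) \<in> indeps (principal_plus M (ground N) A B)"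
      using plus_iff[of X "Y - J"] r J X Y by auto
    moreover have "X \<union> Y = (X \<union> (Y - J)) \<union> J" using J(3) by blast
    ultimately show "X \<union> Y \<in> indeps (principal_sum M N A B)"
      using J(1) indeps_principal_sum[OF M.finite_ground] by blast
  qed
qed

text \<open>Intersecting with \<open>J\<close> preserves a decomposition of \<open>I\<close>. This
  heredity lets minimality of a dependent set be tested on single-element deletions.\<close>

lemma principal_sum_subset_indep:
  assumes "matroid M" "matroid N" "ground M \<inter> ground N = {}" "B \<subseteq> ground N"
    and "I \<in> indeps (principal_sum M N A B)" "J \<subseteq> I"
  shows "J \<in> indeps (principal_sum M N A B)"
proof -
  interpret M: matroid M by fact
  interpret N: matroid N by fact
  interpret P: matroid "principal_plus M (ground N) A B"
    by (rule M.matroid_principal_plus[OF N.finite_ground assms(3,4)])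
  obtain I1 I2 where "I = I1 \<union> I2" "I1 \<in> indeps (principal_plus M (ground N) A B)"
      "I2 \<in> indeps N"
    using assms(5) indeps_principal_sum[OF M.finite_ground] by auto
  then have "J = (J \<inter> I1) \<union> (J \<inter> I2)" "J \<inter> I1 \<in> indeps (principal_plus M (ground N) A B)"
      "J \<inter> I2 \<in> indeps N"
    using assms(6) P.subset_indep N.subset_indep by auto
  then show ?thesis using indeps_principal_sum[OF M.finite_ground] by blast
qed

section \<open>Circuits of the principal sum\<close>

theorem theorem3p15:
  fixes M N :: "'a set_system" and S T A B D :: "'a set"
  assumes "matroid M" and "ground M = S"
    and "matroid N" and "ground N = T"
    and "S \<inter> T = {}"
    and "A \<subseteq> S" and "B \<subseteq> T"
    and "D \<subseteq> S \<union> T"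
  shows "circuit (principal_sum M N A B) D \<longleftrightarrow>
    circuit M D \<or>
    (circuit N D \<and> D \<subseteq> T - B) \<or>
    (\<exists>X Y. D = X \<union> Y \<and> X \<subseteq> S \<and> Y \<subseteq> T \<and>
      (X \<in> indeps M \<and> (\<forall>x\<in>X - A. \<not> coloop (restriction M (X \<union> A)) x)) \<and>
      (cyclic N Y \<and> Y - B \<in> indeps N) \<and>
      int (card X) + int (card Y) - 1 = int (rank M (X \<union> A)) + int (rank N Y))"
proof -
  interpret M: matroid M by fact
  interpret N: matroid N by fact
  define P where "P = principal_sum M N A B"
  have gP: "ground P = S \<union> T" using assms by (simp add: P_def)
  have ind: "X \<union> Y \<in> indeps P \<longleftrightarrow>
      X \<in> indeps M \<and> Y - B \<in> indeps N \<and> card X + card Y \<le> rank M (X \<union> A) + rank N Y"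
    if "X \<subseteq> S" "Y \<subseteq> T" for X Y
    unfolding P_def using principal_sum_indep_iff[of M N B X Y A] that assms by auto
  have fin: "finite X" "finite Y" if "X \<subseteq> S" "Y \<subseteq> T" for X Y
    using that assms(2,4) M.finite_ground N.finite_ground by (auto intro: finite_subset)
  \<comment> \<open>With \<open>Y\<close> empty the rank inequality is automatic for independent
    \<open>X\<close>; \<open>indN\<close> is the same with \<open>X\<close> empty, where
    \<open>Y - B = Y\<close>.\<close>
  have indM: "X \<in> indeps P \<longleftrightarrow> X \<in> indeps M" if "X \<subseteq> S" for X
    using ind[OF that, of "{}"] N.empty_indep M.card_le_rank[of X "X \<union> A"] by auto
  have indN: "Y \<in> indeps P \<longleftrightarrow> Y \<in> indeps N" if "Y \<subseteq> T - B" for Y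
  proof -
    have "Y \<subseteq> T" "Y - B = Y" using that by auto
    then show ?thesis using ind[of "{}" Y] M.empty_indep N.card_le_rank[of Y Y] by auto
  qed
  have circM: "circuit P D \<longleftrightarrow> circuit M D" if "D \<subseteq> S"
  proof -
    have "C \<in> indeps P \<longleftrightarrow> C \<in> indeps M" if "C \<subseteq> D" for C
      using indM that \<open>D \<subseteq> S\<close> by blast
    then show ?thesis using assms(2,8) that unfolding circuit_def gP by (simp add: psubset_eq)
  qed
  have circN: "circuit P D \<longleftrightarrow> circuit N D" if "D \<subseteq> T - B"
  proof -
    have "C \<in> indeps P \<longleftrightarrow> C \<in> indeps N" if "C \<subseteq> D" for C
      using indN that \<open>D \<subseteq> T - B\<close> by blast
    moreover have "D \<subseteq> T" using that by blast
    ultimately show ?thesis using assms(4,8) unfolding circuit_def gP by (simp add: psubset_eq)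
  qed
  let ?three = "\<lambda>X Y. (X \<in> indeps M \<and> (\<forall>x\<in>X - A. \<not> coloop (restriction M (X \<union> A)) x)) \<and>
      (cyclic N Y \<and> Y - B \<in> indeps N) \<and>
      int (card X) + int (card Y) - 1 = int (rank M (X \<union> A)) + int (rank N Y)"
  \<comment> \<open>Condition (3) becomes pure rank statements over the naturals: the integer
    \<open>- 1\<close> moves across as \<open>Suc\<close>, so no truncated subtraction
    occurs.\<close>
  have three_iff: "?three X Y \<longleftrightarrow> X \<in> indeps M \<and> Y - B \<in> indeps N \<and>
      (\<forall>x\<in>X - A. rank M (X \<union> A) \<le> rank M (X \<union> A - {x})) \<and>
      (\<forall>y\<in>Y. rank N Y \<le> rank N (Y - {y})) \<and>
      card X + card Y = Suc (rank M (X \<union> A) + rank N Y)" if "X \<subseteq> S" "Y \<subseteq> T" for X Y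
    using that assms(4)
    by (auto simp: M.coloop_restriction_iff N.cyclic_iff_rank_delete not_less)
  have circ_if: "circuit P (X \<union> Y)" if XY: "X \<subseteq> S" "Y \<subseteq> T" and "?three X Y" for X Y
  proof -
    have h: "X \<in> indeps M" "Y - B \<in> indeps N"
      "\<And>x. x \<in> X - A \<Longrightarrow> rank M (X \<union> A) \<le> rank M (X \<union> A - {x})"
      "\<And>y. y \<in> Y \<Longrightarrow> rank N Y \<le> rank N (Y - {y})"
      "card X + card Y = Suc (rank M (X \<union> A) + rank N Y)"
      using that(3) three_iff[OF XY] by auto
    have dep: "X \<union> Y \<notin> indeps P" using ind[OF XY] h(5) by auto
    have del: "X \<union> Y - {e} \<in> indeps P" if e: "e \<in> X \<union> Y" for e
    proof (cases "e \<in> X")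
      case True
      \<comment> \<open>Deleting an element of \<open>A\<close> from \<open>X\<close> leaves
        \<open>X \<union> A\<close> unchanged, which is why the coloop condition concerns only
        \<open>X - A\<close>.\<close>
      have "rank M (X \<union> A) \<le> rank M (X - {e} \<union> A)"
      proof (cases "e \<in> A")
        case True
        then have "X - {e} \<union> A = X \<union> A" by blast
        then show ?thesis by simp
      next
        case False
        then have "X - {e} \<union> A = X \<union> A - {e}" by blast
        then show ?thesis using h(3)[of e] True False by simp
      qed
      moreover have "Suc (card (X - {e})) = card X"
        using card_Suc_Diff1[OF fin(1)[OF XY] True] .
      moreover have "X - {e} \<in> indeps M" using M.subset_indep[OF h(1)] by blast
      moreover have "X - {e} \<subseteq> S" using XY by blast
      ultimately have "X - {e} \<union> Y \<in> indeps P" using ind[of "X - {e}" Y] XY h by simp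
      moreover have "X \<union> Y - {e} = X - {e} \<union> Y" using True XY assms(5) by blast
      ultimately show ?thesis by simp
    next
      case False
      then have eY: "e \<in> Y" using e by blast
      have "Suc (card (Y - {e})) = card Y"
        using card_Suc_Diff1[OF fin(2)[OF XY] eY] .
      moreover have "Y - {e} - B \<in> indeps N" by (rule N.subset_indep[OF h(2)]) blast
      moreover have "Y - {e} \<subseteq> T" using XY by blast
      ultimately have "X \<union> (Y - {e}) \<in> indeps P"
        using ind[of X "Y - {e}"] XY h(1,5) h(4)[OF eY] by simp
      moreover have "X \<union> Y - {e} = X \<union> (Y - {e})" using False by blast
      ultimately show ?thesis by simp
    qed
    have "C \<in> indeps P" if C: "C \<subset> X \<union> Y" for C
    proof -
      obtain e where e: "e \<in> X \<union> Y" "C \<subseteq> X \<union> Y - {e}" using C by blast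
      show ?thesis
        using principal_sum_subset_indep[OF assms(1,3)] del[OF e(1)] e(2) assms(2,4,5,7)
        unfolding P_def by blast
    qed
    then show ?thesis using dep XY unfolding circuit_def gP by auto
  qed
  have only_if: "circuit M D \<or> (circuit N D \<and> D \<subseteq> T - B) \<or>
      (\<exists>X Y. D = X \<union> Y \<and> X \<subseteq> S \<and> Y \<subseteq> T \<and> ?three X Y)" if "circuit P D"
  proof -
    define X Y where "X = D \<inter> S" and "Y = D \<inter> T"
    have XY: "D = X \<union> Y" "X \<subseteq> S" "Y \<subseteq> T" using assms(8) X_def Y_def by auto
    have dep: "D \<notin> indeps P" and min: "\<And>C. C \<subset> D \<Longrightarrow> C \<in> indeps P"
      using \<open>circuit P D\<close> by (auto simp: circuit_def)
    \<comment> \<open>In the first two cases a dependent subset of \<open>D\<close> has been found,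
      so by minimality it is all of \<open>D\<close>.\<close>
    consider "X \<notin> indeps M" | "Y - B \<notin> indeps N"
      | "X \<in> indeps M" "Y - B \<in> indeps N" "rank M (X \<union> A) + rank N Y < card X + card Y"
      using dep ind[OF XY(2,3)] XY(1) by force
    then show ?thesis
    proof cases
      case 1
      then have "D = X" using min[of X] indM XY by blast
      then show ?thesis using circM that XY(2) by blast
    next
      case 2
      have "Y - B \<subseteq> T - B" using XY by blast
      then have "D = Y - B" using min[of "Y - B"] indN 2 XY(1) by blast
      then show ?thesis using circN that \<open>Y - B \<subseteq> T - B\<close> by blast
    next
      case 3
      \<comment> \<open>Minimality restores the inequality once \<open>x\<close> is deleted, and the
        deletion lowers the left side by exactly one.\<close>
      have delX: "card X + card Y \<le> Suc (rank M (X - {x} \<union> A) + rank N Y)" if "x \<in> X" for x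
      proof -
        have "X - {x} \<union> Y \<subset> D" "X - {x} \<subseteq> S" using that XY assms(5) by auto
        then have "card (X - {x}) + card Y \<le> rank M (X - {x} \<union> A) + rank N Y"
          using min[of "X - {x} \<union> Y"] ind[of "X - {x}" Y] XY(3) by simp
        then show ?thesis using card_Suc_Diff1[OF fin(1)[OF XY(2,3)] that] by linarith
      qed
      have delY: "card X + card Y \<le> Suc (rank M (X \<union> A) + rank N (Y - {y}))" if "y \<in> Y" for y
      proof -
        have "X \<union> (Y - {y}) \<subset> D" "Y - {y} \<subseteq> T" using that XY assms(5) by auto
        then have "card X + card (Y - {y}) \<le> rank M (X \<union> A) + rank N (Y - {y})"
          using min[of "X \<union> (Y - {y})"] ind[of X "Y - {y}"] XY(2) by simp
        then show ?thesis using card_Suc_Diff1[OF fin(2)[OF XY(2,3)] that] by linarith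
      qed
      \<comment> \<open>Deleting any one element bounds the excess by one, so some element must
        exist; strictness then makes the excess exactly one.\<close>
      have "X \<noteq> {} \<or> Y \<noteq> {}" using 3(3) by auto
      then have eq: "card X + card Y = Suc (rank M (X \<union> A) + rank N Y)"
      proof
        assume "X \<noteq> {}"
        then obtain x where "x \<in> X" by blast
        moreover have "rank M (X - {x} \<union> A) \<le> rank M (X \<union> A)" by (rule M.rank_mono) blast
        ultimately show ?thesis using delX[of x] 3(3) by simp
      next
        assume "Y \<noteq> {}"
        then obtain y where "y \<in> Y" by blast
        moreover have "rank N (Y - {y}) \<le> rank N Y" by (rule N.rank_mono) blast
        ultimately show ?thesis using delY[of y] 3(3) by simp
      qed
      \<comment> \<open>With the excess known to be one, the deletion bounds leave no room for
        either rank to drop.\<close>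
      have "rank M (X \<union> A) \<le> rank M (X \<union> A - {x})" if "x \<in> X - A" for x
      proof -
        have "X - {x} \<union> A = X \<union> A - {x}" using that by blast
        then show ?thesis using delX[of x] that eq by simp
      qed
      moreover have "rank N Y \<le> rank N (Y - {y})" if "y \<in> Y" for y
        using delY[OF that] eq by simp
      ultimately have "?three X Y" using three_iff[OF XY(2,3)] 3 eq by blast
      then show ?thesis using XY by blast
    qed
  qed
  have if_dir: "circuit P D" if "circuit M D \<or> (circuit N D \<and> D \<subseteq> T - B) \<or>
      (\<exists>X Y. D = X \<union> Y \<and> X \<subseteq> S \<and> Y \<subseteq> T \<and> ?three X Y)"
    using that
  proof (elim disjE)
    assume "circuit M D"
    then show ?thesis using circM assms(2) by (auto simp: circuit_def)
  next
    assume "circuit N D \<and> D \<subseteq> T - B"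
    then show ?thesis using circN by blast
  next
    assume "\<exists>X Y. D = X \<union> Y \<and> X \<subseteq> S \<and> Y \<subseteq> T \<and> ?three X Y"
    then show ?thesis using circ_if by blast
  qed
  show ?thesis using only_if if_dir unfolding P_def by (rule iffI)
qed

end
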